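(* For every $b\ge1$ and every $d\ge2$, the graph $G_d^\sharp$ contains no ordered copy of $Q_{2,b}$, and $$d_\ell(G_d^\sharp)=\frac12\qquad(1\le\ell\le d).$$ Consequently, for every $b\ge1$, every $\alpha<1/2$ and every $C$ there exist $d$ and a graph on $B_d$ that contains no ordered copy of $Q_{2,b}$ and has at least $C$ levels of density larger than $\alpha$.
   Context: For $d\ge1$, the depth-$d$ binary interval is $B_d=\{0,1\}^d$ with lexicographic order. For $x<y$ in $B_d$ the level is $\delta(x,y)=\min\{i:x_i\ne y_i\}$. The number of pairs $x<y$ in $B_d$ with $\delta(x,y)=\ell$ is $\tau_{\ell,d}=2^{2d-\ell-1}$. For a graph $G$ on $B_d$, $e_\ell(G)$ is the number of edges $xy$ of $G$ ($x<y$) with $\delta(x,y)=\ell$, and $d_\ell(G)=e_\ell(G)/\tau_{\ell,d}$ is the density of level $\ell$. For $x\in B_d$ put $\sigma(x)=x_1+\cdots+x_d \pmod 2$. For $d\ge2$, $G_d^\sharp$ denotes a graph on $B_d$ obtained as follows: take all pairs $xy$ with $\sigma(x)\ne\sigma(y)$; then, only among the $2^{d-1}$ pairs of level $d$ (all of which have $\sigma(x)\neq\sigma(y)$), delete exactly half, so that exactly $2^{d-2}$ level-$d$ pairs (an arbitrary choice) are kept. An ordered copy of an ordered graph $F$ in $G$ is an injective, order-preserving map $V(F)\to V(G)$ sending edges to edges (not necessarily induced). For $b\ge1$, $Q_{2,b}$ is the ordered graph on vertices $1<2<\cdots<b+3$ with edges $12,\ 13,\ 23,\ 34,\ 45,\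 \ldots,\ (b+2)(b+3)$. *)

theory Defs
  imports Complex_Main "HOL-Library.List_Lexorder" "HOL-Library.Ramsey"
begin

text \<open>
  A simple graph is a pair of a vertex set and a set of two-element subsets of it
  (\<^term>\<open>nsets V 2\<close> is the set of all two-element subsets of \<open>V\<close>).
  It is an ordered graph through the order of the vertex type.
\<close>

type_synonym 'a graph = "'a set \<times> 'a set set"

definition graph_on :: "'a set \<Rightarrow> 'a graph \<Rightarrow> bool" where
  "graph_on V G \<longleftrightarrow> fst G = V \<and> snd G \<subseteq> nsets V 2"

definition ordered_copy :: "('a::order \<Rightarrow> 'b::order) \<Rightarrow> 'a graph \<Rightarrow> 'b graph \<Rightarrow> bool" where
  "ordered_copy f F G \<longleftrightarrow>
     f \<in> fst F \<rightarrow> fst G \<and> inj_on f (fst F) \<and> mono_on (fst F) f \<and> (\<forall>e\<in>snd F. f ` e \<in> snd G)"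

definition contains_ordered_copy :: "'b::order graph \<Rightarrow> 'a::order graph \<Rightarrow> bool" where
  "contains_ordered_copy G F \<longleftrightarrow> (\<exists>f. ordered_copy f F G)"

definition Q2 :: "nat \<Rightarrow> nat graph" where
  "Q2 b = ({1..b + 3}, {{1, 2}, {1, 3}} \<union> {{i, i + 1} | i. 2 \<le> i \<and> i \<le> b + 2})"

text \<open>
  Elements of \<open>B\<^sub>d\<close> are lists of length \<open>d\<close> over \<open>{0, 1}\<close>. The order \<open><\<close> on lists
  is the lexicographic one. List positions start at \<open>0\<close>, so the coordinate \<open>x\<^sub>i\<close> with
  \<open>1 \<le> i \<le> d\<close> is \<^term>\<open>x ! (i - 1)\<close>.
\<close>

definition binary :: "nat \<Rightarrow> nat list set" where
  "binary d = {x. length x = d \<and> set x \<subseteq> {0, 1}}"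

definition level :: "nat list \<Rightarrow> nat list \<Rightarrow> nat" where
  "level x y = Min {i \<in> {1..length x}. x ! (i - 1) \<noteq> y ! (i - 1)}"

definition level_pairs :: "nat \<Rightarrow> nat \<Rightarrow> (nat list \<times> nat list) set" where
  "level_pairs d l = {(x, y). x \<in> binary d \<and> y \<in> binary d \<and> x < y \<and> level x y = l}"

text \<open>The closed form \<open>2 ^ (2 * d - l - 1)\<close> is proved in \<open>tau_eq\<close> below.\<close>

definition tau :: "nat \<Rightarrow> nat \<Rightarrow> nat" where
  "tau d l = card (level_pairs d l)"

definition level_edges :: "nat \<Rightarrow> nat \<Rightarrow> nat list graph \<Rightarrow> nat" where
  "level_edges d l G = card {(x, y) \<in> level_pairs d l. {x, y} \<in> snd G}"

definition level_density :: "nat \<Rightarrow> nat \<Rightarrow> nat list graph \<Rightarrow> real" where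
  "level_density d l G = real (level_edges d l G) / real (tau d l)"

definition parity :: "nat list \<Rightarrow> nat" where
  "parity x = sum_list x mod 2"

definition parity_edges :: "nat \<Rightarrow> nat list set set" where
  "parity_edges d = {{x, y} | x y. x \<in> binary d \<and> y \<in> binary d \<and> parity x \<noteq> parity y}"

text \<open>
  The graphs \<open>G\<^sub>d\<^sup>\<sharp>\<close>: \<open>D\<close> is the set of deleted pairs, an arbitrary set of pairs of
  level \<open>d\<close> such that exactly \<open>2 ^ (d - 2)\<close> of the \<open>2 ^ (d - 1)\<close> pairs of level \<open>d\<close> are kept.
\<close>

definition is_sharp_graph :: "nat \<Rightarrow> nat list graph \<Rightarrow> bool" where
  "is_sharp_graph d G \<longleftrightarrow>
     (\<exists>D. D \<subseteq> {{x, y} | x y. (x, y) \<in> level_pairs d d} \<and>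
          card ({{x, y} | x y. (x, y) \<in> level_pairs d d} - D) = 2 ^ (d - 2) \<and>
          G = (binary d, parity_edges d - D))"

lemma finite_binary: "finite (binary d)"
  and card_binary: "card (binary d) = 2 ^ d"
proof -
  have *: "binary d = {x. set x \<subseteq> {0, 1} \<and> length x = d}"
    by (auto simp: binary_def)
  show "finite (binary d)" unfolding * by (rule finite_lists_length_eq) simp
  show "card (binary d) = 2 ^ d" unfolding * by (subst card_lists_length_eq) (auto simp: numeral_2_eq_2)
qed

lemma level_append:
  assumes "a \<noteq> b"
  shows "level (p @ a # u) (p @ b # v) = length p + 1"
  unfolding level_def
proof (rule Min_eqI)
  fix i assume "i \<in> {i \<in> {1..length (p @ a # u)}. (p @ a # u) ! (i - 1) \<noteq> (p @ b # v) ! (i - 1)}"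
  then have "1 \<le> i" "\<not> i - 1 < length p" by (auto simp: nth_append)
  then show "length p + 1 \<le> i" by simp
qed (use assms in auto)

lemma level_pairs_eq:
  assumes "1 \<le> l" "l \<le> d"
  shows "level_pairs d l =
    (\<lambda>(p, u, v). (p @ 0 # u, p @ 1 # v)) ` (binary (l - 1) \<times> binary (d - l) \<times> binary (d - l))"
    (is "_ = ?R")
proof (intro equalityI subsetI)
  fix z assume "z \<in> level_pairs d l"
  then obtain x y where z: "z = (x, y)" and x: "x \<in> binary d" and y: "y \<in> binary d"
    and lt: "x < y" and lev: "level x y = l"
    by (auto simp: level_pairs_def)
  have len: "length x = d" "length y = d" using x y by (auto simp: binary_def)
  have "(\<exists>a v. y = x @ a # v) \<or> (\<exists>p a b u v. a < b \<and> x = p @ a # u \<and> y = p @ b # v)"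
    using lt by (simp add: list_less_def lexord_def)
  with len obtain p a b u v where ab: "a < b" and xy: "x = p @ a # u" "y = p @ b # v"
    by fastforce
  have "a \<in> {0, 1}" "b \<in> {0, 1}" using x y xy by (auto simp: binary_def)
  with ab have "a = 0" "b = 1" by auto
  moreover have "l = length p + 1" using lev level_append[of a b p u v] ab xy by simp
  ultimately have "z = (\<lambda>(p, u, v). (p @ 0 # u, p @ 1 # v)) (p, u, v)"
    "(p, u, v) \<in> binary (l - 1) \<times> binary (d - l) \<times> binary (d - l)"
    using x y xy z by (auto simp: binary_def)
  then show "z \<in> ?R" by (rule image_eqI)
next
  fix z assume "z \<in> ?R"
  then obtain p u v where z: "z = (p @ 0 # u, p @ 1 # v)" "p \<in> binary (l - 1)"
    "u \<in> binary (d - l)" "v \<in> binary (d - l)" by auto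
  have "p @ 0 # u < p @ (1::nat) # v"
    unfolding list_less_def by (intro lexord_append_leftI) simp
  then show "z \<in> level_pairs d l"
    using z assms level_append[of 0 1 p u v] by (auto simp: level_pairs_def binary_def)
qed

lemma tau_eq:
  assumes "1 \<le> l" "l \<le> d"
  shows "tau d l = 2 ^ (2 * d - l - 1)"
proof -
  have "inj_on (\<lambda>(p, u, v). (p @ (0::nat) # u, p @ (1::nat) # v))
          (binary (l - 1) \<times> binary (d - l) \<times> binary (d - l))"
    by (auto simp: inj_on_def binary_def)
  then have "tau d l = 2 ^ (l - 1) * (2 ^ (d - l) * 2 ^ (d - l))"
    unfolding tau_def level_pairs_eq[OF assms]
    by (simp add: card_image card_cartesian_product card_binary)
  also have "\<dots> = 2 ^ ((l - 1) + ((d - l) + (d - l)))" by (simp only: power_add)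
  also have "(l - 1) + ((d - l) + (d - l)) = 2 * d - l - 1" using assms by simp
  finally show ?thesis .
qed

end

theory Submission
  imports Defs
begin

text \<open>
  Every edge of a sharp graph joins an even word to an odd one, so the graph is bipartite and
  in particular triangle-free, whereas the vertices \<open>1, 2, 3\<close> of every \<^term>\<open>Q2 b\<close> span a
  triangle. This excludes copies of \<^term>\<open>Q2 b\<close> (\<open>sharp_graph_no_copy\<close>).

  For the density at a level \<open>l < d\<close>, two words whose first difference is at position \<open>l\<close> still
  have a free last letter. Flipping the last letter of the larger word changes its parity and
  keeps the level, so it matches the pairs of level \<open>l\<close> that are joined with those that are not
  (\<open>card_odd_level_pairs\<close>). At level \<open>d\<close> the words differ in the last letter only, so without
  deletions this level would have density \<open>1\<close>; the deletion of half of its pairs brings it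
  down to \<open>1 / 2\<close>.

  For the last claim, all \<open>d\<close> levels of a sharp graph have density \<open>1 / 2 > \<alpha>\<close>, so any sharp
  graph of depth at least \<open>max C 2\<close> will do.
\<close>

section \<open>Bipartiteness\<close>

lemma doubleton_in_parity_edges_iff:
  "{x, y} \<in> parity_edges d \<longleftrightarrow> x \<in> binary d \<and> y \<in> binary d \<and> parity x \<noteq> parity y"
  unfolding parity_edges_def by (auto simp: doubleton_eq_iff)

lemma parity_edges_triangle_free:
  assumes "{x, y} \<in> parity_edges d" "{x, z} \<in> parity_edges d" "{y, z} \<in> parity_edges d"
  shows False
proof -
  have "parity x < 2" "parity y < 2" "parity z < 2"
    by (simp_all add: parity_def)
  then show False
    using assms unfolding doubleton_in_parity_edges_iff by linarith
qed

lemma sharp_graph_no_copy: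
  assumes "is_sharp_graph d G"
  shows "\<not> contains_ordered_copy G (Q2 b)"
proof
  assume "contains_ordered_copy G (Q2 b)"
  then obtain f where "\<forall>e\<in>snd (Q2 b). f ` e \<in> snd G"
    by (auto simp: contains_ordered_copy_def ordered_copy_def)
  moreover have "snd G \<subseteq> parity_edges d"
    using assms by (auto simp: is_sharp_graph_def)
  ultimately have edge: "f ` e \<in> parity_edges d" if "e \<in> snd (Q2 b)" for e
    using that by blast
  have "{2, 3} \<in> snd (Q2 b)"
    by (auto simp: Q2_def intro!: exI[of _ 2])
  then have "{f 2, f 3} \<in> parity_edges d"
    using edge by fastforce
  moreover have "{f 1, f 2} \<in> parity_edges d" "{f 1, f 3} \<in> parity_edges d"
    using edge[of "{1, 2}"] edge[of "{1, 3}"] by (simp_all add: Q2_def)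
  ultimately show False
    using parity_edges_triangle_free by blast
qed

section \<open>Level densities\<close>

text \<open>
  Densities count ordered pairs, while edges and deleted pairs are unordered. As only pairs
  with \<open>x < y\<close> are counted, passing from one to the other does not change cardinalities.
\<close>

lemma inj_on_level_pairs: "inj_on (\<lambda>(x, y). {x, y}) (level_pairs d l)"
  by (auto simp: inj_on_def level_pairs_def doubleton_eq_iff)

lemma finite_level_pairs: "finite (level_pairs d l)"
  by (rule finite_subset[of _ "binary d \<times> binary d"]) (auto simp: level_pairs_def finite_binary)

definition flip_last :: "nat list \<Rightarrow> nat list" where
  "flip_last y = butlast y @ [1 - last y]"

text \<open>
  Since the words first differ at \<open>l < d\<close>, the last letter of the larger one lies strictly
  behind the position that determines both their order and their level.
\<close>

lemma flip_last_level_pair: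
  assumes "1 \<le> l" "l < d" "(x, y) \<in> level_pairs d l"
  shows "(x, flip_last y) \<in> level_pairs d l"
    and "flip_last (flip_last y) = y"
    and "parity (flip_last y) \<noteq> parity y"
proof -
  obtain p u v where xy: "x = p @ 0 # u" "y = p @ 1 # v"
    and bin: "p \<in> binary (l - 1)" "u \<in> binary (d - l)" "v \<in> binary (d - l)"
    using assms by (auto simp: level_pairs_eq)
  have "v \<noteq> []"
    using bin assms by (auto simp: binary_def)
  then obtain w c where v: "v = w @ [c]"
    by (metis append_butlast_last_id)
  have c: "c = 0 \<or> c = 1"
    using bin v by (auto simp: binary_def)
  have flip: "flip_last y = p @ 1 # (w @ [1 - c])"
    by (simp add: flip_last_def xy v butlast_append)
  have "w @ [1 - c] \<in> binary (d - l)"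
    using bin v c by (auto simp: binary_def)
  then have "(\<lambda>(p, u, v). (p @ 0 # u, p @ 1 # v)) (p, u, w @ [1 - c]) \<in> level_pairs d l"
    unfolding level_pairs_eq[OF assms(1) less_imp_le[OF assms(2)]]
    using bin by (intro imageI) auto
  then show "(x, flip_last y) \<in> level_pairs d l"
    by (simp add: xy(1) flip)
  show "flip_last (flip_last y) = y"
    using c by (auto simp: flip_last_def xy v butlast_append)
  define n where "n = sum_list p + sum_list w + 1"
  have "sum_list (flip_last y) = n + (1 - c)" "sum_list y = n + c"
    unfolding flip unfolding xy v n_def by simp_all
  then have "even (sum_list (flip_last y)) \<noteq> even (sum_list y)"
    using c by auto
  then show "parity (flip_last y) \<noteq> parity y"
    by (metis parity_def even_iff_mod_2_eq_zero)
qed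

lemma card_odd_level_pairs:
  assumes "1 \<le> l" "l < d"
  shows "2 * card {(x, y) \<in> level_pairs d l. parity x \<noteq> parity y} = tau d l"
proof -
  define A where "A = {(x, y) \<in> level_pairs d l. parity x \<noteq> parity y}"
  define B where "B = {(x, y) \<in> level_pairs d l. parity x = parity y}"
  define \<phi> :: "nat list \<times> nat list \<Rightarrow> nat list \<times> nat list"
    where "\<phi> = (\<lambda>(x, y). (x, flip_last y))"
  note flip = flip_last_level_pair[OF assms]
  \<comment> \<open>With only two parities, leaving the parity of \<open>y\<close> means arriving at that of \<open>x\<close>.\<close>
  have third: "k = m" if "k \<noteq> m'" "m' \<noteq> m" "k < 2" "m' < 2" "m < 2" for k m m' :: nat
    using that by linarith
  have lt2: "parity z < 2" for z
    by (simp add: parity_def)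
  have "bij_betw \<phi> A B"
  proof (rule bij_betw_byWitness[where f' = \<phi>])
    show "\<phi> ` A \<subseteq> B"
      by (auto simp: A_def B_def \<phi>_def intro: flip(1) third[OF _ flip(3)[symmetric] lt2 lt2 lt2])
    show "\<phi> ` B \<subseteq> A"
      by (auto simp: A_def B_def \<phi>_def flip(1) dest: flip(3))
  qed (auto simp: A_def B_def \<phi>_def flip(2))
  then have "card A = card B"
    by (rule bij_betw_same_card)
  moreover have "tau d l = card A + card B"
  proof -
    have "level_pairs d l = A \<union> B" "A \<inter> B = {}"
      by (auto simp: A_def B_def)
    then show ?thesis
      unfolding tau_def using finite_level_pairs[of d l]
      by (metis card_Un_disjoint finite_Un)
  qed
  ultimately show ?thesis
    by (simp add: A_def)
qed

lemma parity_neq_bottom_level: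
  assumes "1 \<le> d" "(x, y) \<in> level_pairs d d"
  shows "parity x \<noteq> parity y"
proof -
  obtain p where "x = p @ [0]" "y = p @ [1]"
    using assms by (auto simp: level_pairs_eq binary_def)
  then show ?thesis
    by (simp add: parity_def mod_Suc)
qed

lemma level_edges_sharp_graph:
  assumes "is_sharp_graph d G" "2 \<le> d" "1 \<le> l" "l \<le> d"
  shows "2 * level_edges d l G = tau d l"
proof -
  define P where "P = {{x, y} | x y. (x, y) \<in> level_pairs d d}"
  obtain D where D: "D \<subseteq> P" "card (P - D) = 2 ^ (d - 2)" "G = (binary d, parity_edges d - D)"
    using assms(1) by (auto simp: is_sharp_graph_def P_def)
  show ?thesis
  proof (cases "l = d")
    case True
    let ?E = "{(x, y) \<in> level_pairs d d. {x, y} \<in> snd G}"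
    have parity_edge: "{x, y} \<in> parity_edges d" if "(x, y) \<in> level_pairs d d" for x y
      using that parity_neq_bottom_level[of d x y] assms
      by (auto simp: doubleton_in_parity_edges_iff level_pairs_def)
    have "card ?E = card ((\<lambda>(x, y). {x, y}) ` ?E)"
      by (rule card_image[symmetric], rule inj_on_subset[OF inj_on_level_pairs[of d d]]) auto
    also have "(\<lambda>(x, y). {x, y}) ` ?E = P - D"
      unfolding P_def D(3) using parity_edge by (auto simp: image_iff)
    finally have "level_edges d l G = 2 ^ (d - 2)"
      by (simp add: level_edges_def True D(2))
    moreover have "tau d l = 2 ^ Suc (d - 2)"
      using tau_eq[of d d] True assms(2) by (simp add: Suc_diff_Suc numeral_2_eq_2)
    ultimately show ?thesis
      by simp
  next
    case False
    \<comment> \<open>A pair determines its level, so the deletions at level \<open>d\<close> do not affect level \<open>l\<close>.\<close>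
    have undeleted: "{x, y} \<notin> D" if "(x, y) \<in> level_pairs d l" for x y
    proof
      assume "{x, y} \<in> D"
      then obtain x' y' where "(x', y') \<in> level_pairs d d" "{x, y} = {x', y'}"
        using D(1) by (auto simp: P_def)
      then show False
        using that False by (auto simp: level_pairs_def doubleton_eq_iff)
    qed
    have "{(x, y) \<in> level_pairs d l. {x, y} \<in> snd G} =
      {(x, y) \<in> level_pairs d l. parity x \<noteq> parity y}"
      using undeleted
      by (auto simp: D(3) doubleton_in_parity_edges_iff level_pairs_def)
    then show ?thesis
      using card_odd_level_pairs[of l d] assms False by (simp add: level_edges_def)
  qed
qed

lemma level_density_sharp_graph:
  assumes "is_sharp_graph d G" "2 \<le> d" "1 \<le> l" "l \<le> d"
  shows "level_density d l G = 1 / 2"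
proof -
  have "real (tau d l) = 2 * real (level_edges d l G)"
    using level_edges_sharp_graph[OF assms] by (metis of_nat_mult of_nat_numeral)
  moreover have "tau d l \<noteq> 0"
    using tau_eq[OF assms(3,4)] by simp
  ultimately show ?thesis
    by (simp add: level_density_def)
qed

section \<open>Existence of sharp graphs\<close>

lemma sharp_graph_exists:
  assumes "2 \<le> d"
  obtains G where "is_sharp_graph d G" "graph_on (binary d) G"
proof -
  define P where "P = {{x, y} | x y. (x, y) \<in> level_pairs d d}"
  have P: "P = (\<lambda>(x, y). {x, y}) ` level_pairs d d"
    by (auto simp: P_def)
  have fin: "finite P"
    unfolding P by (intro finite_imageI finite_level_pairs)
  have "card P = tau d d"
    unfolding P tau_def by (rule card_image) (rule inj_on_level_pairs)
  then have card_P: "card P = 2 * 2 ^ (d - 2)"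
    using tau_eq[of d d] assms by (simp add: Suc_diff_Suc numeral_2_eq_2 flip: power_Suc)
  then obtain D where D: "D \<subseteq> P" "card D = 2 ^ (d - 2)" "finite D"
    using obtain_subset_with_card_n[of "2 ^ (d - 2)" P] by auto
  have "card (P - D) = 2 ^ (d - 2)"
    using D fin card_P by (simp add: card_Diff_subset)
  then have "is_sharp_graph d (binary d, parity_edges d - D)"
    using D(1) unfolding is_sharp_graph_def P_def by blast
  moreover have "parity_edges d \<subseteq> nsets (binary d) 2"
    by (auto simp: parity_edges_def nsets_def card_2_iff)
  then have "graph_on (binary d) (binary d, parity_edges d - D)"
    by (auto simp: graph_on_def)
  ultimately show thesis
    by (rule that)
qed

theorem proposition9p1:
  shows "(\<forall>b\<ge>1. \<forall>d\<ge>2. \<forall>G. is_sharp_graph d G \<longrightarrow>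
            \<not> contains_ordered_copy G (Q2 b) \<and>
            (\<forall>l\<in>{1..d}. level_density d l G = 1 / 2)) \<and>
         (\<forall>b\<ge>1. \<forall>\<alpha>::real. \<alpha> < 1 / 2 \<longrightarrow> (\<forall>C::nat. \<exists>d\<ge>1. \<exists>G.
            graph_on (binary d) G \<and> \<not> contains_ordered_copy G (Q2 b) \<and>
            card {l \<in> {1..d}. level_density d l G > \<alpha>} \<ge> C))"
proof (intro conjI allI impI ballI)
  fix b d :: nat and G
  assume "2 \<le> d" "is_sharp_graph d G"
  then show "\<not> contains_ordered_copy G (Q2 b)"
    by (intro sharp_graph_no_copy)
next
  fix b d l :: nat and G
  assume "2 \<le> d" "is_sharp_graph d G" "l \<in> {1..d}"
  then show "level_density d l G = 1 / 2"
    by (simp add: level_density_sharp_graph)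
next
  fix b :: nat and \<alpha> :: real and C :: nat
  assume \<alpha>: "\<alpha> < 1 / 2"
  define d where "d = max C 2"
  have d: "2 \<le> d" "C \<le> d"
    by (simp_all add: d_def)
  obtain G where G: "is_sharp_graph d G" "graph_on (binary d) G"
    using sharp_graph_exists[OF d(1)] .
  have "{l \<in> {1..d}. level_density d l G > \<alpha>} = {1..d}"
    using \<alpha> by (auto simp: level_density_sharp_graph[OF G(1) d(1)])
  then have "C \<le> card {l \<in> {1..d}. level_density d l G > \<alpha>}"
    using d(2) by simp
  then show "\<exists>d\<ge>1. \<exists>G. graph_on (binary d) G \<and> \<not> contains_ordered_copy G (Q2 b) \<and>
      C \<le> card {l \<in> {1..d}. level_density d l G > \<alpha>}"
    using d(1) G sharp_graph_no_copy[OF G(1)]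
    by (intro exI[of _ d] conjI exI[of _ G]) simp_all
qed

end
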